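(* Let $q$ be an odd prime power, let $\alpha$ be a primitive element of $\mathbb{F}_{q^2}$, and let $b,c,d\in\mathbb{F}_{q^2}$. Then the number $M$ of zeros of $f(x)=x^{q+1}+bx^q+cx+d$ in $\mathbb{F}_{q^2}$ is given by $$M=\begin{cases} 1, & b=c=d=0,\\ q+1, & b=c=0,\ d\in\mathbb{F}_q^*,\\ 0, & b=c=0,\ d\notin\mathbb{F}_q,\\ 1, & b^q=c\neq0,\ d\in\mathbb{F}_q,\ d=b^{q+1},\\ q+1, & b^q=c\neq0,\ d\in\mathbb{F}_q,\ d\neq b^{q+1},\\ 0, & b^q=c\neq0,\ d\notin\mathbb{F}_q,\\ 1-|N'|, & b^q\neq c,\ b^{q+1}=c^{q+1},\ b^qd=cd^q,\\ 2-|N'|, & b^q\neq c,\ b^{q+1}=c^{q+1},\ b^qd\neq cd^q,\\ 2-|N|, & b^{q+1}\neq c^{q+1}. \end{cases}$$ Here $$h(x)=(d-bc)^qx^2+\bigl(\operatorname{Tr}(d)-b^{q+1}-c^{q+1}\bigr)x+d-bc;$$ $k$ is a fixed integer with $0<k\le q$ and $\operatorname{Tr}(\alpha^k)=0$; in the cases where $b^{q+1}=c^{q+1}$ and $b^q\ne c$, $k'$ is a fixed integer with $0\le k'\le q$, $k'\neq k$, and $b^q\alpha^{k'q}+c\alpha^{k'}=0$; and $$N'=\{\,i\in\{0,1,\dots,q\}\setminus\{k,k'\} : h(\alpha^{i(q-1)})=0\,\},\qquad N=\{\,i\in\{0,1,\dots,q\}\setminus\{k\} : h(\alpha^{i(q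-1)})=0\,\}.$$
   Context: $\mathbb{F}_q\subset\mathbb{F}_{q^2}$ are the finite fields with $q$ and $q^2$ elements; a primitive element of $\mathbb{F}_{q^2}$ is a generator of the cyclic group $\mathbb{F}_{q^2}^*$. $\operatorname{Tr}:\mathbb{F}_{q^2}\to\mathbb{F}_q$ is $\operatorname{Tr}(x)=x^q+x$. Zeros are counted as distinct elements of $\mathbb{F}_{q^2}$. *)

theory Defs
  imports Complex_Main "HOL-Number_Theory.Number_Theory" "HOL-Library.Cardinality"
begin

definition is_subfield :: "'a::field set \<Rightarrow> bool" where
  "is_subfield K \<longleftrightarrow>
     0 \<in> K \<and> 1 \<in> K \<and>
     (\<forall>x\<in>K. \<forall>y\<in>K. x + y \<in> K \<and> x * y \<in> K) \<and>
     (\<forall>x\<in>K. - x \<in> K \<and> inverse x \<in> K)"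

definition primitive_element :: "'a::field \<Rightarrow> bool" where
  "primitive_element \<alpha> \<longleftrightarrow> \<alpha> \<noteq> 0 \<and> range (\<lambda>n::int. \<alpha> powi n) = UNIV - {0}"

definition Tr :: "nat \<Rightarrow> 'a::field \<Rightarrow> 'a" where
  "Tr q x = x ^ q + x"

definition f :: "nat \<Rightarrow> 'a::field \<Rightarrow> 'a \<Rightarrow> 'a \<Rightarrow> 'a \<Rightarrow> 'a" where
  "f q b c d x = x ^ (q + 1) + b * x ^ q + c * x + d"

definition h :: "nat \<Rightarrow> 'a::field \<Rightarrow> 'a \<Rightarrow> 'a \<Rightarrow> 'a \<Rightarrow> 'a" where
  "h q b c d x =
     (d - b * c) ^ q * x ^ 2 + (Tr q d - b ^ (q + 1) - c ^ (q + 1)) * x + (d - b * c)"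

(* The excluded set E is {k} for N and {k, k'} for N'. *)
definition h_zero_indices ::
    "nat \<Rightarrow> 'a::field \<Rightarrow> 'a \<Rightarrow> 'a \<Rightarrow> 'a \<Rightarrow> nat set \<Rightarrow> nat set" where
  "h_zero_indices q \<alpha> b c d E = {i \<in> {0..q} - E. h q b c d (\<alpha> ^ (i * (q - 1))) = 0}"

end

theory Submission
  imports Defs
begin

text \<open>
  Write \<open>x\<^sup>q\<close> as the conjugate of \<open>x\<close> and \<open>x ^ (q + 1)\<close> as its norm, and put
  \<open>e = c - b\<^sup>q\<close> and \<open>D = d - b c\<close>. The shift \<open>X = x + b\<close> turns \<open>f(x)\<close> into
  \<open>X ^ (q + 1) + e X + D\<close>.

  If \<open>e = 0\<close>, the zeros are the elements of norm \<open>- D\<close>. As the norm maps the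
  cyclic group of order \<open>q\<^sup>2 - 1\<close> onto \<open>F\<^sub>q\<^sup>*\<close>, every fibre over a nonzero element of \<open>F\<^sub>q\<close> has
  \<open>q + 1\<close> elements. This settles the first six cases.

  If \<open>e \<noteq> 0\<close>, a zero \<open>X\<close> is determined by its norm \<open>n\<close>, since \<open>e X = - (D + n)\<close>. Taking norms, \<open>n\<close>
  is an element of \<open>F\<^sub>q\<close> with \<open>p(n) = n\<^sup>2 + T n + D ^ (q + 1) = 0\<close>, where
  \<open>T = D + D\<^sup>q - e ^ (q + 1)\<close>, and conversely. The same number \<open>T\<close> is the middle coefficient of \<open>h\<close>, and for \<open>D \<noteq> 0\<close>
  the substitution \<open>z = D\<^sup>q u\<close> matches the zeros \<open>u\<close> of \<open>h\<close> of norm \<open>1\<close> with the zeros \<open>z\<close>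
  of \<open>p\<close> whose norm is the product of the two roots of \<open>p\<close>. The polynomial \<open>p\<close> has coefficients in
  \<open>F\<^sub>q\<close>, so it splits in the quadratic extension and conjugation either fixes both roots or swaps them. In
  the first case the roots lie in \<open>F\<^sub>q\<close>, in the second each has norm equal to their product, and
  a double root does both. Either way (lemma \<open>root_dichotomy\<close>)
  the number of zeros of \<open>f\<close> plus the number of zeros of \<open>h\<close> of norm \<open>1\<close> is \<open>2\<close>.

  The elements of norm \<open>1\<close> are the \<open>\<alpha> ^ (i * (q - 1))\<close> with \<open>0 \<le> i \<le> q\<close>. The index \<open>k\<close> stands for \<open>- 1\<close>,
  and \<open>h(- 1) = e ^ (q + 1) \<noteq> 0\<close>, so that removing \<open>k\<close> changes nothing. The index \<open>k'\<close> stands for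
  \<open>- c / b\<^sup>q\<close>, which is a zero of \<open>h\<close> exactly if \<open>b\<^sup>q d = c d\<^sup>q\<close>: only then does removing \<open>k'\<close>
  lower the count by one.\<close>

section \<open>Conjugation and the cyclic multiplicative group\<close>

text \<open>
  Multiplication by a nonzero element permutes the nonzero elements of the subfield, so it preserves
  their product. For the whole field this says that conjugation is an involution, and for the
  subfield with \<open>q\<close> elements that its elements are self-conjugate.\<close>

lemma subfield_power_card:
  fixes K :: "'a::{field,finite} set"
  assumes K: "is_subfield K" and x: "x \<in> K"
  shows "x ^ card K = x"
proof (cases "x = 0")
  case True
  have "card K > 0" using x by (auto simp: card_gt_0_iff)
  with True show ?thesis by simp
next
  case False
  have K0: "0 \<in> K" and Kmult: "\<And>y z. y \<in> K \<Longrightarrow> z \<in> K \<Longrightarrow> y * z \<in> K"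
    using K by (auto simp: is_subfield_def)
  have Kstar: "(\<lambda>y. x * y) ` (K - {0}) = K - {0}"
  proof (rule card_subset_eq)
    show "(\<lambda>y. x * y) ` (K - {0}) \<subseteq> K - {0}"
      using False x Kmult by auto
    show "card ((\<lambda>y. x * y) ` (K - {0})) = card (K - {0})"
      using False by (intro card_image inj_onI) simp
  qed simp
  have "(\<Prod>y\<in>K-{0}. x * y) = \<Prod>((\<lambda>y. x * y) ` (K - {0}))"
    using False by (subst prod.reindex) (auto intro: inj_onI)
  then have "x ^ card (K - {0}) * \<Prod>(K-{0}) = 1 * \<Prod>(K-{0})"
    unfolding Kstar prod.distrib by simp
  moreover have "\<Prod>(K-{0}) \<noteq> 0" by (simp add: prod_zero_iff)
  ultimately have "x ^ card (K - {0}) = 1" by (metis mult_right_cancel)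
  moreover have "card K = Suc (card (K - {0}))"
    using card.remove[OF _ K0] by simp
  ultimately show ?thesis by simp
qed

locale quadratic_extension =
  fixes q :: nat and \<alpha> :: "'a::{field,finite}"
  assumes primepow_q: "primepow q" and odd_q: "odd q"
    and card_field: "CARD('a) = q ^ 2"
    and primitive: "primitive_element \<alpha>"
begin

lemma q_gt_1: "q > 1"
  using primepow_q primepow_gt_Suc_0 by simp

lemma order_eq: "q ^ 2 - 1 = (q - 1) * (q + 1)"
  using q_gt_1 by (simp add: power2_eq_square algebra_simps)

lemma order_pos: "q ^ 2 - 1 > 0"
  using q_gt_1 by (simp only: order_eq) simp

text \<open>
  The characteristic is the prime of which \<open>q\<close> is a power, because it divides the cardinality
  \<open>q\<^sup>2\<close>; hence conjugation is an iterate of the Frobenius map.\<close>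

lemma conj_add: "(x + y :: 'a) ^ q = x ^ q + y ^ q"
proof -
  obtain p n where p: "prime p" "n > 0" "q = p ^ n"
    using primepow_q by (auto simp: primepow_def)
  have prime_char: "prime CHAR('a)"
    by (intro prime_CHAR_semidom finite_imp_CHAR_pos) simp
  have "CHAR('a) dvd p ^ (n * 2)"
    using CHAR_dvd_CARD[where 'a = 'a] p(3) card_field by (simp add: power_mult)
  then have "CHAR('a) dvd p"
    using prime_char prime_dvd_power by blast
  then have "CHAR('a) = p"
    using prime_char p(1) primes_dvd_imp_eq by blast
  then show ?thesis
    using freshmans_dream'[OF prime_char, of q n] p(3) by simp
qed

lemma conj_minus: "(- x :: 'a) ^ q = - (x ^ q)"
  using odd_q by (simp add: power_minus_odd)

lemma conj_diff: "(x - y :: 'a) ^ q = x ^ q - y ^ q"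
  using conj_add[of x "- y"] by (simp add: conj_minus)

lemma conj_conj: "((x :: 'a) ^ q) ^ q = x"
  using subfield_power_card[of UNIV x]
  by (simp add: is_subfield_def card_field power2_eq_square power_mult)

lemma norm_fixed: "((x :: 'a) ^ (q + 1)) ^ q = x ^ (q + 1)"
  by (simp add: power_mult_distrib conj_conj mult.commute)

lemmas conj_simps = conj_add conj_diff conj_minus conj_conj power_mult_distrib power_divide

lemma cancel_dvd: "(q - 1) * (q + 1) dvd (q - 1) * j \<longleftrightarrow> q + 1 dvd j"
  "(q - 1) * (q + 1) dvd (q + 1) * j \<longleftrightarrow> q - 1 dvd j"
  using nat_mult_dvd_cancel1[of "q - 1" "q + 1" j] nat_mult_dvd_cancel1[of "q + 1" "q - 1" j] q_gt_1
  by (simp_all only: mult.commute zero_less_diff add_pos_pos zero_less_one trans_less_add2)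

lemma alpha_nonzero: "\<alpha> \<noteq> 0"
  using primitive by (simp add: primitive_element_def)

lemma power_order: "x \<noteq> 0 \<Longrightarrow> (x :: 'a) ^ (q ^ 2 - 1) = 1"
proof -
  assume "x \<noteq> 0"
  have "Suc (q ^ 2 - 1) = q * q"
    using order_pos by (simp add: power2_eq_square)
  then have "x ^ Suc (q ^ 2 - 1) = x"
    using conj_conj[of x] by (simp only: power_mult)
  then have "x * x ^ (q ^ 2 - 1) = x * 1" by simp
  then show ?thesis using \<open>x \<noteq> 0\<close> by (metis mult_left_cancel)
qed

text \<open>
  The integer exponents allowed for a primitive element reduce modulo \<open>q\<^sup>2 - 1\<close>, so the reduced
  exponents still reach every nonzero element; injectivity then follows by counting.\<close>

lemma bij_betw_alpha_powers: "bij_betw (\<lambda>i. \<alpha> ^ i) {..<q ^ 2 - 1} (UNIV - {0})"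
proof -
  have img: "(\<lambda>i. \<alpha> ^ i) ` {..<q ^ 2 - 1} = UNIV - {0}"
  proof (intro equalityI subsetI)
    fix x :: 'a assume "x \<in> UNIV - {0}"
    then obtain n :: int where n: "x = \<alpha> powi n"
      using primitive by (auto simp: primitive_element_def)
    define m where "m = nat (n mod int (q ^ 2 - 1))"
    have m: "int m = n mod int (q ^ 2 - 1)" "m < q ^ 2 - 1"
    proof -
      have pos: "int (q ^ 2 - 1) > 0" using order_pos by (simp only: of_nat_0_less_iff)
      show "int m = n mod int (q ^ 2 - 1)"
        unfolding m_def using pos_mod_sign[OF pos] by (rule int_nat_eq[THEN trans, OF if_P])
      then show "m < q ^ 2 - 1"
        using pos_mod_bound[OF pos, of n] by linarith
    qed
    have "n = int m + int (q ^ 2 - 1) * (n div int (q ^ 2 - 1))"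
      using m(1) by simp
    then have "x = \<alpha> powi (int m + int (q ^ 2 - 1) * (n div int (q ^ 2 - 1)))"
      using n by simp
    also have "\<dots> = \<alpha> ^ m * (\<alpha> ^ (q ^ 2 - 1)) powi (n div int (q ^ 2 - 1))"
      using alpha_nonzero by (simp only: power_int_add power_int_mult power_int_of_nat simp_thms)
    finally have "x = \<alpha> ^ m" using power_order[OF alpha_nonzero] by simp
    then show "x \<in> (\<lambda>i. \<alpha> ^ i) ` {..<q ^ 2 - 1}"
      using m(2) by blast
  qed (use alpha_nonzero in auto)
  have "card (UNIV - {0 :: 'a}) = q ^ 2 - 1"
    by (simp add: card_Diff_singleton card_field)
  then show ?thesis
    using img by (auto simp: bij_betw_def intro!: eq_card_imp_inj_on)
qed

lemma alpha_power_eq_one_iff: "\<alpha> ^ n = 1 \<longleftrightarrow> (q ^ 2 - 1) dvd n"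
proof -
  let ?m = "q ^ 2 - 1"
  have "\<alpha> ^ n = \<alpha> ^ (?m * (n div ?m) + n mod ?m)"
    by (simp only: mult_div_mod_eq)
  also have "\<dots> = \<alpha> ^ (n mod ?m)"
    by (simp only: power_add power_mult power_order[OF alpha_nonzero] power_one mult_1)
  also have "\<dots> = 1 \<longleftrightarrow> n mod ?m = 0"
  proof
    assume "\<alpha> ^ (n mod ?m) = 1"
    then show "n mod ?m = 0"
      using inj_onD[OF bij_betw_imp_inj_on[OF bij_betw_alpha_powers], of "n mod ?m" 0]
        mod_less_divisor[OF order_pos] order_pos by (simp only: power_0 lessThan_iff)
  next
    assume "n mod ?m = 0"
    then show "\<alpha> ^ (n mod ?m) = 1" by (simp only: power_0)
  qed
  finally show ?thesis by (simp add: dvd_eq_mod_eq_0)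
qed

lemma alpha_power_exists:
  assumes "x \<noteq> 0" obtains j where "x = \<alpha> ^ j" "j < q ^ 2 - 1"
  using bij_betw_imp_surj_on[OF bij_betw_alpha_powers] assms by blast

text \<open>
  If \<open>x = \<alpha> ^ j\<close> is self-conjugate, then \<open>q\<^sup>2 - 1\<close> divides \<open>j (q - 1)\<close>, that is, \<open>q + 1\<close> divides \<open>j\<close>.
  This gives at once that every such element is a norm, that there are at most \<open>q\<close> self-conjugate
  elements, and, as \<open>q + 1\<close> is even, that each of them is a square in the extension.\<close>

lemma fixed_is_norm_power:
  assumes "x \<noteq> 0" "x ^ q = x"
  obtains m where "x = (\<alpha> ^ m) ^ (q + 1)" "m < q - 1"
proof -
  obtain j where j: "x = \<alpha> ^ j" "j < q ^ 2 - 1" using alpha_power_exists assms(1) .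
  have "x * x ^ (q - 1) = x"
    using assms(2) q_gt_1 by (simp flip: power_Suc)
  then have "x ^ (q - 1) = 1" using assms(1) by (metis mult_cancel_left2)
  then have "\<alpha> ^ (j * (q - 1)) = 1" using j(1) by (simp only: power_mult)
  then have "(q - 1) * (q + 1) dvd (q - 1) * j"
    unfolding alpha_power_eq_one_iff order_eq by (simp add: mult.commute)
  then have "q + 1 dvd j" by (simp only: cancel_dvd)
  then obtain m where m: "j = (q + 1) * m" by blast
  have "(q + 1) * m < (q + 1) * (q - 1)"
    using m j(2) unfolding order_eq by (simp add: mult.commute)
  then have "m < q - 1" using mult_less_cancel1 by blast
  moreover have "x = (\<alpha> ^ m) ^ (q + 1)"
    unfolding j(1) m by (simp only: power_mult[symmetric] mult.commute)
  ultimately show thesis using that by blast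
qed

lemma subfield_eq_fixed:
  assumes "is_subfield K" "card K = q"
  shows "K = {x :: 'a. x ^ q = x}"
proof (rule card_seteq)
  show "K \<subseteq> {x. x ^ q = x}" using subfield_power_card assms by fastforce
  have "{x :: 'a. x ^ q = x} \<subseteq> insert 0 ((\<lambda>m. (\<alpha> ^ m) ^ (q + 1)) ` {..<q - 1})"
    using fixed_is_norm_power by blast
  then have "card {x :: 'a. x ^ q = x} \<le> card (insert 0 ((\<lambda>m. (\<alpha> ^ m) ^ (q + 1)) ` {..<q - 1}))"
    by (intro card_mono) auto
  also have "\<dots> \<le> Suc (card ((\<lambda>m. (\<alpha> ^ m) ^ (q + 1)) ` {..<q - 1}))"
    by (rule card_insert_le_m1[of "Suc n" for n, simplified]) simp
  also have "\<dots> \<le> Suc (q - 1)"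
    using card_image_le[of "{..<q - 1}" "\<lambda>m. (\<alpha> ^ m) ^ (q + 1)"] by simp
  finally show "card {x :: 'a. x ^ q = x} \<le> card K" using assms(2) q_gt_1 by simp
qed simp

lemma fixed_has_sqrt:
  assumes "(x :: 'a) ^ q = x" obtains s where "s ^ 2 = x"
proof (cases "x = 0")
  case True then show thesis using that[of 0] by simp
next
  case False
  then obtain m where "x = (\<alpha> ^ m) ^ (q + 1)" using fixed_is_norm_power assms by metis
  moreover have "even (q + 1)" using odd_q by simp
  then obtain r where "q + 1 = 2 * r" by (elim evenE)
  ultimately show thesis using that[of "(\<alpha> ^ m) ^ r"] by (metis power_even_eq)
qed

text \<open>
  In characteristic \<open>2\<close> the element \<open>\<alpha> ^ ((q\<^sup>2 - 1) / 2)\<close>, a square root of \<open>1\<close>, would have to be \<open>1\<close>,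
  although the exponent is smaller than the order of \<open>\<alpha>\<close>.\<close>

lemma two_nonzero: "(2 :: 'a) \<noteq> 0"
proof
  assume two: "(2 :: 'a) = 0"
  obtain r where r: "q = 2 * r + 1" using odd_q by (metis oddE)
  define y where "y = \<alpha> ^ (r * (q + 1))"
  have "r * (q + 1) * 2 = q ^ 2 - 1"
    unfolding order_eq using r by simp
  then have "y ^ 2 = \<alpha> ^ (q ^ 2 - 1)"
    unfolding y_def by (metis power_mult)
  then have "y ^ 2 = 1" using power_order alpha_nonzero by simp
  moreover have "(1 :: 'a) = -1"
    using two by (metis add_eq_0_iff one_add_one)
  ultimately have "y = 1" using power2_eq_1_iff by metis
  then have "(q - 1) * (q + 1) dvd r * (q + 1)"
    unfolding y_def alpha_power_eq_one_iff order_eq .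
  then have "q - 1 dvd r" by (simp only: cancel_dvd mult.commute[of r])
  then show False using r q_gt_1 by (auto dest: dvd_imp_le)
qed

section \<open>The norm and its fibres\<close>

lemma bij_betw_unit_circle: "bij_betw (\<lambda>i. \<alpha> ^ (i * (q - 1))) {0..q} {u. u ^ (q + 1) = 1}"
  unfolding bij_betw_def
proof (intro conjI equalityI subsetI)
  have lt: "i * (q - 1) < q ^ 2 - 1" if "i \<le> q" for i
  proof -
    have "i * (q - 1) < (q + 1) * (q - 1)" using that q_gt_1 by (intro mult_strict_right_mono) auto
    then show ?thesis by (simp only: order_eq mult.commute)
  qed
  show "inj_on (\<lambda>i. \<alpha> ^ (i * (q - 1))) {0..q}"
    using bij_betw_imp_inj_on[OF bij_betw_alpha_powers] lt q_gt_1
    by (intro inj_onI) (auto dest!: inj_onD)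
next
  fix u assume "u \<in> (\<lambda>i. \<alpha> ^ (i * (q - 1))) ` {0..q}"
  then obtain i where "u = \<alpha> ^ (i * (q - 1))" by blast
  then have "u ^ (q + 1) = (\<alpha> ^ (q ^ 2 - 1)) ^ i"
    unfolding order_eq by (simp only: power_mult[symmetric] mult_ac)
  then show "u \<in> {u. u ^ (q + 1) = 1}" using power_order alpha_nonzero by simp
next
  fix u :: 'a assume "u \<in> {u. u ^ (q + 1) = 1}"
  then have u: "u ^ (q + 1) = 1" by simp
  then have "u \<noteq> 0" by auto
  then obtain j where j: "u = \<alpha> ^ j" "j < q ^ 2 - 1" using alpha_power_exists by blast
  have "\<alpha> ^ (j * (q + 1)) = 1"
    using u unfolding j(1) by (simp only: power_mult)
  then have "(q - 1) * (q + 1) dvd (q + 1) * j"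
    unfolding alpha_power_eq_one_iff order_eq by (simp only: mult.commute[of j])
  then have "q - 1 dvd j" by (simp only: cancel_dvd)
  then obtain i where i: "j = i * (q - 1)" by (metis dvdE mult.commute)
  have "i * (q - 1) < (q + 1) * (q - 1)" using i j(2) unfolding order_eq by (simp add: mult.commute)
  then have "i < q + 1" using mult_less_cancel2 by blast
  then show "u \<in> (\<lambda>i. \<alpha> ^ (i * (q - 1))) ` {0..q}" using i j(1) by auto
qed

text \<open>
  The fibre is a coset of the group of elements of norm \<open>1\<close>.\<close>

lemma card_norm_fibre:
  assumes "w \<noteq> 0" "w ^ q = w"
  shows "card {y :: 'a. y ^ (q + 1) = w} = q + 1"
proof -
  obtain m where m: "w = (\<alpha> ^ m) ^ (q + 1)" using fixed_is_norm_power assms by blast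
  define a where "a = \<alpha> ^ m"
  have a: "a \<noteq> 0" "w = a ^ (q + 1)" using alpha_nonzero m by (auto simp: a_def)
  have "bij_betw (\<lambda>u. a * u) {u. u ^ (q + 1) = 1} {y. y ^ (q + 1) = w}"
    using a by (intro bij_betw_byWitness[where f' = "\<lambda>y. y / a"])
      (auto simp: power_mult_distrib power_divide simp del: power_Suc)
  then have "card {y. y ^ (q + 1) = w} = card {u :: 'a. u ^ (q + 1) = 1}"
    by (metis bij_betw_same_card)
  also have "\<dots> = card {0..q}"
    by (metis bij_betw_same_card bij_betw_unit_circle)
  finally show ?thesis by simp
qed

section \<open>Quadratics with self-conjugate coefficients\<close>

text \<open>
  Conjugation permutes the two roots of the quadratic, and a root \<open>z\<close> has \<open>z ^ (q + 1) = P\<close> exactly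
  if it is conjugate to the other root, because \<open>P\<close> is the product of the roots. So the first set
  collects the roots that conjugation fixes, and the second those that it sends to the other root. A double root belongs to
  both sets.\<close>

lemma root_dichotomy:
  assumes T: "T ^ q = T" and P: "P ^ q = P" "P \<noteq> 0"
  shows "card {z :: 'a. z ^ q = z \<and> z ^ 2 + T * z + P = 0}
       + card {z :: 'a. z ^ (q + 1) = P \<and> z ^ 2 + T * z + P = 0} = 2"
proof -
  have "2 ^ q = (2 :: 'a)"
    using conj_add[of 1 1] by simp
  then have "4 ^ q = (4 :: 'a)"
    using power_mult_distrib[of "2 :: 'a" 2 q] by simp
  then have "(T ^ 2 - 4 * P) ^ q = T ^ 2 - 4 * P"
    using T P by (simp add: conj_simps power2_eq_square)
  then obtain s where s: "s ^ 2 = T ^ 2 - 4 * P" using fixed_has_sqrt by blast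
  define z1 z2 where "z1 = (- T + s) / 2" and "z2 = (- T - s) / 2"
  have twice: "2 * z1 = - T + s" "2 * z2 = - T - s"
    unfolding z1_def z2_def using two_nonzero by simp_all
  have "2 * (z1 + z2) = 2 * (- T)"
    unfolding distrib_left twice by simp
  then have sum12: "z1 + z2 = - T"
    using two_nonzero by (metis mult_left_cancel)
  have "(2 * z1) * (2 * z2) = T ^ 2 - s ^ 2"
    unfolding twice by (simp add: algebra_simps power2_eq_square)
  then have "2 * (2 * (z1 * z2)) = 2 * (2 * P)"
    using s by simp
  then have prod12: "z1 * z2 = P"
    using two_nonzero by (metis mult_left_cancel)
  have root_iff: "z ^ 2 + T * z + P = 0 \<longleftrightarrow> z = z1 \<or> z = z2" for z
  proof -
    have T_eq: "T = - (z1 + z2)" using sum12 by simp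
    have "z ^ 2 + T * z + P = (z - z1) * (z - z2)"
      unfolding T_eq prod12[symmetric] by (simp add: algebra_simps power2_eq_square)
    then show ?thesis by simp
  qed
  have nz: "z1 \<noteq> 0" "z2 \<noteq> 0" using prod12 P by auto
  have "(z1 ^ 2 + T * z1 + P) ^ q = 0"
    using root_iff[of z1] q_gt_1 by simp
  then have "(z1 ^ q) ^ 2 + T * z1 ^ q + P = 0"
    using T P by (simp add: conj_simps power2_eq_square)
  then have conj1: "z1 ^ q = z1 \<or> z1 ^ q = z2" by (simp add: root_iff)
  have conj_sum: "z1 ^ q + z2 ^ q = z1 + z2"
    using T sum12 by (metis conj_add conj_minus)
  define R C where "R = {z. z ^ q = z \<and> z ^ 2 + T * z + P = 0}"
    and "C = {z. z ^ (q + 1) = P \<and> z ^ 2 + T * z + P = 0}"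
  have RC: "R = {z \<in> {z1, z2}. z ^ q = z}" "C = {z \<in> {z1, z2}. z ^ q * z = z1 * z2}"
    unfolding R_def C_def root_iff prod12 by (auto simp: mult.commute)
  consider "z1 = z2" | "z1 \<noteq> z2" "z1 ^ q = z1" "z2 ^ q = z2"
    | "z1 \<noteq> z2" "z1 ^ q = z2" "z2 ^ q = z1"
    using conj1 conj_sum by (metis add_left_cancel add.commute)
  then have "card R + card C = 2"
  proof cases
    case 1
    then have "R = {z1}" "C = {z1}" using RC conj1 by auto
    then show ?thesis by simp
  next
    case 2
    then have "R = {z1, z2}" "C = {}" using RC nz by auto
    then show ?thesis using 2 by simp
  next
    case 3
    then have "R = {}" "C = {z1, z2}" using RC by (auto simp: mult.commute)
    then show ?thesis using 3 by simp
  qed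
  then show ?thesis unfolding R_def C_def .
qed

section \<open>The zeros of the two polynomials\<close>

text \<open>
  The equation reads \<open>e X = - (D + n)\<close> with \<open>n = X ^ (q + 1)\<close>, so \<open>X\<close> can be recovered from its norm.
  A self-conjugate \<open>n\<close> arises in this way if and only if the norm of \<open>- (D + n) / e\<close> is \<open>n\<close>
  itself, and this condition is the quadratic equation on the right.\<close>

lemma card_zeros_via_norm:
  fixes e D T :: 'a
  assumes e: "e \<noteq> 0" and T: "T = D + D ^ q - e ^ (q + 1)"
  shows "card {X. X ^ (q + 1) + e * X + D = 0}
       = card {n. n ^ q = n \<and> n ^ 2 + T * n + D ^ (q + 1) = 0}"
proof (rule bij_betw_same_card[of "\<lambda>X. X ^ (q + 1)"],
    rule bij_betw_byWitness[where f' = "\<lambda>n. - (D + n) / e"])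
  have key: "(D + n) ^ (q + 1) = e ^ (q + 1) * n \<longleftrightarrow> n ^ 2 + T * n + D ^ (q + 1) = 0"
    if "n ^ q = n" for n
  proof -
    have "(D + n) ^ (q + 1) - e ^ (q + 1) * n = n ^ 2 + T * n + D ^ (q + 1)"
      using that unfolding T by (simp add: conj_add algebra_simps power2_eq_square)
    then show ?thesis by (metis right_minus_eq)
  qed
  have neg: "(- x) ^ (q + 1) = x ^ (q + 1)" for x :: 'a
    using odd_q by (simp add: power_minus_even)
  show "\<forall>X\<in>{X. X ^ (q + 1) + e * X + D = 0}. - (D + X ^ (q + 1)) / e = X"
  proof
    fix X assume "X \<in> {X. X ^ (q + 1) + e * X + D = 0}"
    then have "e * X = - (D + X ^ (q + 1))" by (simp add: eq_neg_iff_add_eq_0 algebra_simps)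
    then show "- (D + X ^ (q + 1)) / e = X" using e by (metis nonzero_mult_div_cancel_left)
  qed
  show norm_back: "\<forall>n\<in>{n. n ^ q = n \<and> n ^ 2 + T * n + D ^ (q + 1) = 0}. (- (D + n) / e) ^ (q + 1) = n"
  proof
    fix n assume "n \<in> {n. n ^ q = n \<and> n ^ 2 + T * n + D ^ (q + 1) = 0}"
    then have "(D + n) ^ (q + 1) = e ^ (q + 1) * n" using key by simp
    then show "(- (D + n) / e) ^ (q + 1) = n"
      unfolding power_divide neg using e by simp
  qed
  show "(\<lambda>X. X ^ (q + 1)) ` {X. X ^ (q + 1) + e * X + D = 0}
      \<subseteq> {n. n ^ q = n \<and> n ^ 2 + T * n + D ^ (q + 1) = 0}"
  proof clarify
    fix X assume "X ^ (q + 1) + e * X + D = 0"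
    then have "e * X = - (D + X ^ (q + 1))" by (simp add: eq_neg_iff_add_eq_0 algebra_simps)
    then have "(D + X ^ (q + 1)) ^ (q + 1) = e ^ (q + 1) * X ^ (q + 1)"
      by (metis neg power_mult_distrib)
    then show "(X ^ (q + 1)) ^ q = X ^ (q + 1) \<and> (X ^ (q + 1)) ^ 2 + T * X ^ (q + 1) + D ^ (q + 1) = 0"
      using key[OF norm_fixed] norm_fixed by blast
  qed
  show "(\<lambda>n. - (D + n) / e) ` {n. n ^ q = n \<and> n ^ 2 + T * n + D ^ (q + 1) = 0}
      \<subseteq> {X. X ^ (q + 1) + e * X + D = 0}"
  proof clarify
    fix n assume "n ^ q = n" "n ^ 2 + T * n + D ^ (q + 1) = 0"
    then have "(- (D + n) / e) ^ (q + 1) = n" using norm_back by blast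
    then show "(- (D + n) / e) ^ (q + 1) + e * (- (D + n) / e) + D = 0"
      using e by simp
  qed
qed

text \<open>
  Multiplying the equation by \<open>D ^ q\<close> makes it monic in \<open>z = D ^ q * u\<close>. Its constant term becomes
  the norm of \<open>D\<close>, which is also the norm of \<open>z\<close> when \<open>u\<close> has norm \<open>1\<close>.\<close>

lemma card_circle_zeros:
  fixes D T :: 'a
  assumes "D \<noteq> 0"
  shows "card {u. u ^ (q + 1) = 1 \<and> D ^ q * u ^ 2 + T * u + D = 0}
       = card {z. z ^ (q + 1) = D ^ (q + 1) \<and> z ^ 2 + T * z + D ^ (q + 1) = 0}"
proof (rule bij_betw_same_card[of "\<lambda>u. D ^ q * u"],
    rule bij_betw_byWitness[where f' = "\<lambda>z. z / D ^ q"])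
  have norm_conj: "(D ^ q) ^ (q + 1) = D ^ (q + 1)"
    by (simp add: conj_conj mult.commute)
  have poly: "(D ^ q * u) ^ 2 + T * (D ^ q * u) + D ^ (q + 1) = D ^ q * (D ^ q * u ^ 2 + T * u + D)" for u
    by (simp add: algebra_simps power2_eq_square)
  show "(\<lambda>u. D ^ q * u) ` {u. u ^ (q + 1) = 1 \<and> D ^ q * u ^ 2 + T * u + D = 0}
      \<subseteq> {z. z ^ (q + 1) = D ^ (q + 1) \<and> z ^ 2 + T * z + D ^ (q + 1) = 0}"
    by (clarify, intro conjI, (simp only: power_mult_distrib norm_conj; simp), (simp only: poly; simp))
  show "(\<lambda>z. z / D ^ q) ` {z. z ^ (q + 1) = D ^ (q + 1) \<and> z ^ 2 + T * z + D ^ (q + 1) = 0}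
      \<subseteq> {u. u ^ (q + 1) = 1 \<and> D ^ q * u ^ 2 + T * u + D = 0}"
  proof clarify
    fix z assume z: "z ^ (q + 1) = D ^ (q + 1)" "z ^ 2 + T * z + D ^ (q + 1) = 0"
    have "(z / D ^ q) ^ (q + 1) = 1"
      unfolding power_divide norm_conj z(1) using assms by simp
    moreover have "D ^ q * (z / D ^ q) ^ 2 + T * (z / D ^ q) + D = 0"
      using poly[of "z / D ^ q"] z(2) assms by simp
    ultimately show "(z / D ^ q) ^ (q + 1) = 1 \<and> D ^ q * (z / D ^ q) ^ 2 + T * (z / D ^ q) + D = 0"
      by blast
  qed
qed (use assms in auto)

lemma f_shift: "f q b c d (x :: 'a) = (x + b) ^ (q + 1) + (c - b ^ q) * (x + b) + (d - b * c)"
  by (simp add: f_def conj_add conj_conj algebra_simps)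

lemma card_f_zeros_shift:
  "card {x. f q b c d x = 0} = card {X :: 'a. X ^ (q + 1) + (c - b ^ q) * X + (d - b * c) = 0}"
  by (rule bij_betw_same_card[of "\<lambda>x. x + b"], rule bij_betw_byWitness[where f' = "\<lambda>X. X - b"])
    (auto simp: f_shift)

text \<open>
  This identity links \<open>h\<close> to \<open>f\<close>: the linear coefficient of \<open>h\<close> is the one that appears in the
  equation for the norms of the zeros of the shifted \<open>f\<close>.\<close>

lemma h_middle_coeff:
  "Tr q d - b ^ (q + 1) - c ^ (q + 1)
   = (d - b * c) + (d - b * c) ^ q - (c - b ^ q :: 'a) ^ (q + 1)"
  by (simp add: Tr_def conj_simps algebra_simps)

lemma card_f_zeros_plus_card_h_zeros:
  assumes "b ^ q \<noteq> (c :: 'a)"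
  shows "card {x. f q b c d x = 0} + card {u. u ^ (q + 1) = 1 \<and> h q b c d u = 0} = 2"
proof -
  define e D T where "e = c - b ^ q" and "D = d - b * c" and "T = D + D ^ q - e ^ (q + 1)"
  have e: "e \<noteq> 0" using assms by (simp add: e_def)
  have T: "T ^ q = T"
    unfolding T_def conj_diff conj_add conj_conj norm_fixed by (simp add: add.commute)
  have h: "h q b c d u = D ^ q * u ^ 2 + T * u + D" for u
    unfolding h_def h_middle_coeff by (simp add: D_def T_def e_def)
  have M: "card {x. f q b c d x = 0} = card {n. n ^ q = n \<and> n ^ 2 + T * n + D ^ (q + 1) = 0}"
    unfolding card_f_zeros_shift using card_zeros_via_norm[OF e T_def] by (simp add: e_def D_def)
  show ?thesis
  proof (cases "D = 0")
    case False
    then show ?thesis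
      using root_dichotomy[OF T norm_fixed, of D] M unfolding h card_circle_zeros[OF False] by simp
  next
    case True
    (* The norm equation n (n + T) = 0 has two distinct self-conjugate roots, and h is T u. *)
    have Tnz: "T \<noteq> 0" using e True q_gt_1 by (simp add: T_def power_0_left)
    have "n ^ 2 + T * n = n * (n - (- T))" for n by (simp add: algebra_simps power2_eq_square)
    then have "{n. n ^ q = n \<and> n ^ 2 + T * n + D ^ (q + 1) = 0} = {0, - T}"
      using True q_gt_1 T by (auto simp: conj_minus eq_neg_iff_add_eq_0)
    moreover have no_h: "{u. u ^ (q + 1) = 1 \<and> h q b c d u = 0} = {}"
      using Tnz True q_gt_1 by (auto simp: h power_0_left)
    ultimately show ?thesis using M Tnz unfolding no_h by simp
  qed
qed

lemma h_minus_one: "h q b c d (- 1 :: 'a) = (c - b ^ q) ^ (q + 1)"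
  by (simp add: h_def Tr_def conj_simps algebra_simps)

text \<open>
  With \<open>v = - c / b ^ q\<close>, all terms of \<open>(b ^ q)\<^sup>2 * h(v)\<close> that involve \<open>b * c\<close> or the norms of \<open>b\<close> and
  \<open>c\<close> cancel.\<close>

lemma h_at_minus_c_over_conj_b:
  assumes "b ^ q * v = - (c :: 'a)"
  shows "(b ^ q) ^ 2 * h q b c d v = (d ^ q * c - d * b ^ q) * (c - b ^ q)"
proof -
  define B C E where "B = b ^ q" and "C = c ^ q" and "E = d ^ q"
  have v: "B * v = - c"
    using assms by (simp add: B_def)
  have "B ^ 2 * h q b c d v
      = (E - B * C) * (B * v) ^ 2 + (E + d - b * B - c * C) * (B * v) * B + (d - b * c) * B ^ 2"
    by (simp add: h_def Tr_def conj_simps B_def C_def E_def algebra_simps power2_eq_square)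
  also have "\<dots> = (E * c - d * B) * (c - B)"
    unfolding v by (simp add: algebra_simps power2_eq_square)
  finally show ?thesis unfolding B_def E_def .
qed

lemma card_h_zero_indices:
  "card (h_zero_indices q \<alpha> b c d {}) = card {u. u ^ (q + 1) = 1 \<and> h q b c d u = 0}"
proof (rule bij_betw_same_card)
  let ?g = "\<lambda>i. \<alpha> ^ (i * (q - 1))"
  have "inj_on ?g (h_zero_indices q \<alpha> b c d {})"
    using bij_betw_imp_inj_on[OF bij_betw_unit_circle]
    by (rule inj_on_subset) (auto simp: h_zero_indices_def)
  moreover have "?g ` h_zero_indices q \<alpha> b c d {}
      = {u \<in> ?g ` {0..q}. h q b c d u = 0}"
    by (auto simp: h_zero_indices_def)
  ultimately show "bij_betw ?g (h_zero_indices q \<alpha> b c d {}) {u. u ^ (q + 1) = 1 \<and> h q b c d u = 0}"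
    using bij_betw_imp_surj_on[OF bij_betw_unit_circle] by (simp add: bij_betw_def)
qed

text \<open>
  Here the zero set is the norm fibre over \<open>b ^ (q + 1) - d\<close>, translated by \<open>- b\<close>.\<close>

lemma card_f_zeros_norm_fibre:
  "card {x. f q b (b ^ q) d x = 0}
   = (if d = b ^ (q + 1) then 1 else if d ^ q = d then q + 1 else (0 :: nat))" for b d :: 'a
proof -
  define w where "w = b ^ (q + 1) - d"
  have "X ^ (q + 1) + (b ^ q - b ^ q) * X + (d - b * b ^ q) = 0 \<longleftrightarrow> X ^ (q + 1) = w" for X
    by (auto simp: w_def algebra_simps eq_diff_eq)
  then have fibre: "card {x. f q b (b ^ q) d x = 0} = card {X. X ^ (q + 1) = w}"
    unfolding card_f_zeros_shift by simp
  have w0: "w = 0 \<longleftrightarrow> d = b ^ (q + 1)"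
    by (auto simp: w_def)
  have wq: "w ^ q = w \<longleftrightarrow> d ^ q = d"
    unfolding w_def conj_diff norm_fixed by simp
  consider "w = 0" | "w \<noteq> 0" "w ^ q = w" | "w \<noteq> 0" "w ^ q \<noteq> w" by blast
  then show ?thesis
  proof cases
    case 1
    then have "{X. X ^ (q + 1) = w} = {0}" by auto
    then show ?thesis unfolding fibre using 1 w0 by simp
  next
    case 2
    then show ?thesis unfolding fibre card_norm_fibre[OF 2] using w0 wq by simp
  next
    case 3
    then have "{X. X ^ (q + 1) = w} = {}" using norm_fixed by blast
    then show ?thesis unfolding fibre using 3 w0 wq by simp
  qed
qed

section \<open>The excluded indices\<close>

lemma alpha_conj_quotient: "\<alpha> ^ (i * q) = \<alpha> ^ i * \<alpha> ^ (i * (q - 1))"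
proof -
  have "i * q = i + i * (q - 1)" using q_gt_1 by (simp add: algebra_simps)
  then show ?thesis by (simp only: power_add)
qed

lemma trace_zero_index:
  assumes "Tr q (\<alpha> ^ k) = 0"
  shows "\<alpha> ^ (k * (q - 1)) = - 1"
proof -
  have "\<alpha> ^ k * (\<alpha> ^ (k * (q - 1)) + 1) = 0"
    using assms by (simp add: Tr_def alpha_conj_quotient distrib_left flip: power_mult)
  then show ?thesis using alpha_nonzero by (simp add: eq_neg_iff_add_eq_0)
qed

end

section \<open>The zero count\<close>

theorem lemma3p5:
  fixes q k k' :: nat
    and \<alpha> b c d :: "'a::{field,finite}"
    and Fq :: "'a set"
  assumes "primepow q" and "odd q"
    and "CARD('a) = q ^ 2"
    and "is_subfield Fq" and "card Fq = q"
    and "primitive_element \<alpha>"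
    and "0 < k" and "k \<le> q" and "Tr q (\<alpha> ^ k) = 0"
    and "b ^ (q + 1) = c ^ (q + 1) \<and> b ^ q \<noteq> c \<Longrightarrow>
           k' \<le> q \<and> k' \<noteq> k \<and> b ^ q * \<alpha> ^ (k' * q) + c * \<alpha> ^ k' = 0"
  shows "let M = int (card {x. f q b c d x = 0});
             N = h_zero_indices q \<alpha> b c d {k};
             N' = h_zero_indices q \<alpha> b c d {k, k'}
         in (b = 0 \<and> c = 0 \<and> d = 0 \<longrightarrow> M = 1) \<and>
            (b = 0 \<and> c = 0 \<and> d \<in> Fq - {0} \<longrightarrow> M = int q + 1) \<and>
            (b = 0 \<and> c = 0 \<and> d \<notin> Fq \<longrightarrow> M = 0) \<and>
            (b ^ q = c \<and> c \<noteq> 0 \<and> d \<in> Fq \<and> d = b ^ (q + 1) \<longrightarrow> M = 1) \<and>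
            (b ^ q = c \<and> c \<noteq> 0 \<and> d \<in> Fq \<and> d \<noteq> b ^ (q + 1) \<longrightarrow> M = int q + 1) \<and>
            (b ^ q = c \<and> c \<noteq> 0 \<and> d \<notin> Fq \<longrightarrow> M = 0) \<and>
            (b ^ q \<noteq> c \<and> b ^ (q + 1) = c ^ (q + 1) \<and> b ^ q * d = c * d ^ q
               \<longrightarrow> M = 1 - int (card N')) \<and>
            (b ^ q \<noteq> c \<and> b ^ (q + 1) = c ^ (q + 1) \<and> b ^ q * d \<noteq> c * d ^ q
               \<longrightarrow> M = 2 - int (card N')) \<and>
            (b ^ (q + 1) \<noteq> c ^ (q + 1) \<longrightarrow> M = 2 - int (card N))"
proof -
  interpret quadratic_extension q \<alpha>
    using assms by unfold_locales
  have Fq: "Fq = {x. x ^ q = x}"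
    using subfield_eq_fixed assms by blast
  define M where "M = int (card {x. f q b c d x = 0})"
  define I where "I = h_zero_indices q \<alpha> b c d {}"
  have fin: "finite I" by (simp add: I_def h_zero_indices_def)
  (* Exclusions act on one index set, so only the membership of k and k' in it matters. *)
  have remove: "h_zero_indices q \<alpha> b c d E = I - E" for E
    by (auto simp: I_def h_zero_indices_def)
  have circle: "M = (if d = b ^ (q + 1) then 1 else if d \<in> Fq then int q + 1 else 0)" if "b ^ q = c"
    using card_f_zeros_norm_fibre[of b d] that unfolding M_def Fq by auto
  have norm_in_Fq: "b ^ (q + 1) \<in> Fq"
    unfolding Fq using norm_fixed by blast
  have zero: "0 ^ q = (0 :: 'a)" "0 ^ (q + 1) = (0 :: 'a)"
    using q_gt_1 by auto
  have line: "M = 2 - int (card I) \<and> k \<notin> I" if ne: "b ^ q \<noteq> c"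
  proof
    show "M = 2 - int (card I)"
      using card_f_zeros_plus_card_h_zeros[OF ne, of d] unfolding M_def I_def card_h_zero_indices
      by linarith
    have "h q b c d (- 1) \<noteq> 0"
      unfolding h_minus_one using ne by simp
    then show "k \<notin> I"
      unfolding I_def h_zero_indices_def by (simp add: trace_zero_index[OF assms(9), simplified])
  qed
  have k'_mem: "k' \<in> I \<longleftrightarrow> b ^ q * d = c * d ^ q"
    if ne: "b ^ q \<noteq> c" and norm_eq: "b ^ (q + 1) = c ^ (q + 1)"
  proof -
    let ?v = "\<alpha> ^ (k' * (q - 1))"
    have k': "k' \<le> q" "b ^ q * \<alpha> ^ (k' * q) + c * \<alpha> ^ k' = 0"
      using assms(10) that by auto
    have "\<alpha> ^ k' * (b ^ q * ?v + c) = 0"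
      using k'(2) unfolding alpha_conj_quotient by (simp add: algebra_simps)
    then have "b ^ q * ?v = - c"
      using alpha_nonzero by (simp add: eq_neg_iff_add_eq_0)
    note h_val = h_at_minus_c_over_conj_b[OF this, of d]
    have "b \<noteq> 0"
      using ne norm_eq zero by (metis power_eq_0_iff)
    then have "h q b c d ?v = 0 \<longleftrightarrow> (b ^ q) ^ 2 * h q b c d ?v = 0" by simp
    also have "\<dots> \<longleftrightarrow> b ^ q * d = c * d ^ q"
      unfolding h_val using ne by (auto simp: mult.commute)
    finally show ?thesis using k'(1) by (simp add: I_def h_zero_indices_def)
  qed
  have "M = 1 - int (card (I - {k, k'}))"
    if "b ^ q \<noteq> c" "b ^ (q + 1) = c ^ (q + 1)" "b ^ q * d = c * d ^ q"
  proof -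
    have "k' \<in> I" "k \<notin> I" using that k'_mem line by auto
    then have "I - {k, k'} = I - {k'}" "card I = Suc (card (I - {k'}))"
      using card.remove[OF fin] by auto
    then show ?thesis using line that(1) by simp
  qed
  moreover have "M = 2 - int (card (I - {k, k'}))"
    if "b ^ q \<noteq> c" "b ^ (q + 1) = c ^ (q + 1)" "b ^ q * d \<noteq> c * d ^ q"
  proof -
    have "I - {k, k'} = I" using that k'_mem line by auto
    then show ?thesis using line that(1) by simp
  qed
  moreover have "M = 2 - int (card (I - {k}))" if "b ^ (q + 1) \<noteq> c ^ (q + 1)"
  proof -
    have "b ^ q \<noteq> c"
    proof
      assume "b ^ q = c"
      then have "c ^ (q + 1) = b ^ (q + 1)"
        by (simp add: conj_conj mult.commute flip: \<open>b ^ q = c\<close>)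
      then show False using that by simp
    qed
    then show ?thesis using line by simp
  qed
  ultimately show ?thesis
    unfolding Let_def remove M_def[symmetric]
    using circle norm_in_Fq zero by auto
qed

end
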